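(* Let $\gamma(s)$ be a geodesic on the cone $K\subset\mathbb{R}^{N+1}$. Then $$I=\|\gamma(s)\|^2-\frac{\langle\gamma(s),\gamma'(s)\rangle^2}{\|\gamma'(s)\|^2}$$ remains constant along $\gamma$. Geometrically, $I$ is the squared distance from the vertex $O$ to the tangent line of $\gamma$.
   Context: Let $\Gamma$ be a closed $C^3$ Riemannian manifold, $\dim\Gamma=n$, isometrically embedded as a $C^3$ submanifold in the affine hyperplane $\{x^{N+1}=1\}\subset\mathbb{R}^{N+1}$, $N>n$. The cone over $\Gamma$ is $K=\{tp\mid p\in\Gamma,\ t\in\mathbb{R}\}\subset\mathbb{R}^{N+1}$ with the metric induced by the Euclidean metric, and $O=0$ is its vertex. $\langle\cdot,\cdot\rangle$ and $\|\cdot\|$ are Euclidean. A geodesic on $K$ is a non-constant $C^1$ curve $\gamma(s)\in K\subset\mathbb{R}^{N+1}$ of constant speed which, where $\gamma\ne O$, is $C^2$ with $\gamma''(s)$ orthogonal to $T_{\gamma(s)}K$. *)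

theory Defs
  imports "HOL-Analysis.Analysis"
begin

text \<open>
  For open \<open>S\<close> in a finite-dimensional space, \<open>C_k_on k f S\<close> is the usual notion of a \<open>C\<^sup>k\<close> map:
  all iterated directional derivatives up to order \<open>k\<close> exist as directional values of Frechet
  derivatives and are continuous.
\<close>

primrec C_k_on :: "nat \<Rightarrow> ('a::euclidean_space \<Rightarrow> 'b::euclidean_space) \<Rightarrow> 'a set \<Rightarrow> bool" where
  "C_k_on 0 f S \<longleftrightarrow> continuous_on S f"
| "C_k_on (Suc k) f S \<longleftrightarrow>
     (\<forall>x\<in>S. f differentiable (at x)) \<and>
     (\<forall>v. C_k_on k (\<lambda>x. frechet_derivative f (at x) v) S)"

text \<open>
  Embedded submanifolds without boundary, by flattening charts: locally some \<open>C\<^sup>k\<close> diffeomorphism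
  of the ambient space carries \<open>M\<close> to an \<open>n\<close>-dimensional linear subspace.
\<close>

definition C_k_submanifold :: "nat \<Rightarrow> nat \<Rightarrow> 'a::euclidean_space set \<Rightarrow> bool" where
  "C_k_submanifold k n M \<longleftrightarrow>
     (\<forall>p\<in>M. \<exists>U V \<phi> \<psi> L.
        open U \<and> p \<in> U \<and> open (V :: 'a set) \<and> homeomorphism U V \<phi> \<psi> \<and>
        C_k_on k \<phi> U \<and> C_k_on k \<psi> V \<and>
        subspace L \<and> dim L = n \<and> \<phi> ` (U \<inter> M) = V \<inter> L)"

text \<open>
  The set of velocities of \<open>C\<^sup>1\<close> curves in \<open>M\<close> through \<open>x\<close>; this is the tangent space of \<open>M\<close> at
  every point \<open>x\<close> near which \<open>M\<close> is an embedded submanifold.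
\<close>

definition tangent_space :: "'a::euclidean_space set \<Rightarrow> 'a \<Rightarrow> 'a set" where
  "tangent_space M x =
     {v. \<exists>c \<epsilon>. 0 < (\<epsilon>::real) \<and> c C1_differentiable_on {-\<epsilon><..<\<epsilon>} \<and> c ` {-\<epsilon><..<\<epsilon>} \<subseteq> M \<and>
           c 0 = x \<and> (c has_vector_derivative v) (at 0)}"

text \<open>Two-sided: unlike the library's \<^const>\<open>cone\<close>, all real multiples are taken.\<close>

definition cone_over :: "'a::euclidean_space set \<Rightarrow> 'a set" where
  "cone_over \<Gamma> = {t *\<^sub>R p | t p. p \<in> \<Gamma>}"

text \<open>
  Curves are parametrised by an interval \<open>J\<close> of any kind; derivatives at an endpoint belonging to
  \<open>J\<close> are one-sided.
\<close>

definition velocity :: "real set \<Rightarrow> (real \<Rightarrow> 'a::euclidean_space) \<Rightarrow> real \<Rightarrow> 'a" where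
  "velocity J \<gamma> s = vector_derivative \<gamma> (at s within J)"

definition cone_geodesic :: "'a::euclidean_space set \<Rightarrow> real set \<Rightarrow> (real \<Rightarrow> 'a) \<Rightarrow> bool" where
  "cone_geodesic K J \<gamma> \<longleftrightarrow>
     is_interval J \<and> \<gamma> ` J \<subseteq> K \<and> \<not> \<gamma> constant_on J \<and>
     \<gamma> differentiable_on J \<and> continuous_on J (velocity J \<gamma>) \<and>
     (\<lambda>s. norm (velocity J \<gamma> s)) constant_on J \<and>
     (\<forall>s\<in>J. \<gamma> s \<noteq> 0 \<longrightarrow> velocity J \<gamma> differentiable (at s within J)) \<and>
     continuous_on {s\<in>J. \<gamma> s \<noteq> 0} (velocity J (velocity J \<gamma>)) \<and>
     (\<forall>s\<in>J. \<gamma> s \<noteq> 0 \<longrightarrow>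
        (\<forall>w\<in>tangent_space K (\<gamma> s). orthogonal (velocity J (velocity J \<gamma>) s) w))"

definition tangent_line :: "real set \<Rightarrow> (real \<Rightarrow> 'a::euclidean_space) \<Rightarrow> real \<Rightarrow> 'a set" where
  "tangent_line J \<gamma> s = {\<gamma> s + t *\<^sub>R velocity J \<gamma> s | t. True}"

definition vertex_invariant :: "real set \<Rightarrow> (real \<Rightarrow> 'a::euclidean_space) \<Rightarrow> real \<Rightarrow> real" where
  "vertex_invariant J \<gamma> s =
     (norm (\<gamma> s))\<^sup>2 - (\<gamma> s \<bullet> velocity J \<gamma> s)\<^sup>2 / (norm (velocity J \<gamma> s))\<^sup>2"

end

theory Submission imports Defs begin

text \<open>
  Write \<open>v = \<gamma>'\<close>; its length \<open>c\<close> is constant, and positive because \<open>\<gamma>\<close> is not constant. The cone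
  contains the ray through each of its points, so the position vector is itself tangent to the cone,
  and off the vertex the acceleration is orthogonal to it. Hence \<open>(\<gamma> \<bullet> v)' = c\<^sup>2\<close> there, and
  \<open>I' = 2 (\<gamma> \<bullet> v) - 2 (\<gamma> \<bullet> v) c\<^sup>2 / c\<^sup>2 = 0\<close>.

  A geodesic may pass through the vertex, where its acceleration need not exist, but there is no
  need to cut the interval at those parameters. By Cauchy--Schwarz \<open>0 \<le> I \<le> \<parallel>\<gamma>\<parallel>\<^sup>2\<close>, and \<open>\<parallel>\<gamma>\<parallel>\<^sup>2\<close>
  vanishes to second order where \<open>\<gamma>\<close> meets the vertex, so \<open>I\<close> has derivative \<open>0\<close> at such a
  parameter too. Having derivative \<open>0\<close> on the whole interval, \<open>I\<close> is constant. The geometric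
  reading of \<open>I\<close> is Pythagoras' theorem.
\<close>

text \<open>The radial curve \<open>t \<mapsto> (1 + t) x\<close> stays in the cone and has velocity \<open>x\<close>.\<close>

lemma position_in_tangent_space_cone_over:
  assumes "x \<in> cone_over \<Gamma>"
  shows "x \<in> tangent_space (cone_over \<Gamma>) x"
proof -
  obtain u p where x: "x = u *\<^sub>R p" and "p \<in> \<Gamma>"
    using assms by (auto simp: cone_over_def)
  define c where "c = (\<lambda>t::real. (1 + t) *\<^sub>R x)"
  have deriv: "(c has_vector_derivative x) (at t)" for t
    unfolding c_def by (auto intro!: derivative_eq_intros)
  have "c C1_differentiable_on {-1<..<1}"
    unfolding C1_differentiable_on_def using deriv by (intro exI[of _ "\<lambda>_. x"]) auto
  moreover have "c t \<in> cone_over \<Gamma>" for t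
    unfolding cone_over_def c_def x using \<open>p \<in> \<Gamma>\<close> by auto
  ultimately show ?thesis
    unfolding tangent_space_def using deriv[of 0]
    by (intro CollectI exI[of _ c] exI[of _ "1::real"]) (auto simp: c_def)
qed

text \<open>The foot of the perpendicular from the origin is at parameter \<open>- (x \<bullet> v) / \<parallel>v\<parallel>\<^sup>2\<close>.\<close>

lemma infdist_0_line_squared:
  fixes x v :: "'a::euclidean_space"
  assumes "v \<noteq> 0"
  shows "(infdist 0 {x + t *\<^sub>R v | t. True})\<^sup>2 = (norm x)\<^sup>2 - (x \<bullet> v)\<^sup>2 / (norm v)\<^sup>2"
proof -
  let ?L = "{x + t *\<^sub>R v | t. True}"
  define t0 where "t0 = - (x \<bullet> v) / (v \<bullet> v)"
  have vv: "v \<bullet> v > 0" using assms by simp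
  have expand: "(norm (x + t *\<^sub>R v))\<^sup>2 = x \<bullet> x + 2 * t * (x \<bullet> v) + t\<^sup>2 * (v \<bullet> v)" for t
    unfolding power2_norm_eq_inner
    by (simp add: inner_add_left inner_add_right inner_commute[of v x] power2_eq_square
        algebra_simps)
  have xv: "x \<bullet> v = - t0 * (v \<bullet> v)"
    using vv by (simp add: t0_def)
  have pyth: "(norm (x + t *\<^sub>R v))\<^sup>2 = (norm (x + t0 *\<^sub>R v))\<^sup>2 + (t - t0)\<^sup>2 * (norm v)\<^sup>2" for t
    unfolding expand power2_norm_eq_inner[of v] xv by (simp add: power2_eq_square algebra_simps)
  have "norm (x + t0 *\<^sub>R v) \<le> norm (x + t *\<^sub>R v)" for t
    by (rule power2_le_imp_le) (simp_all add: pyth[of t])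
  then have "norm (x + t0 *\<^sub>R v) \<le> infdist 0 ?L"
    by (subst infdist_notempty) (auto intro!: cINF_greatest)
  moreover have "infdist 0 ?L \<le> norm (x + t0 *\<^sub>R v)"
    using infdist_le[of "x + t0 *\<^sub>R v" ?L 0] by auto
  ultimately have "(infdist 0 ?L)\<^sup>2 = (norm (x + t0 *\<^sub>R v))\<^sup>2"
    by simp
  also have "\<dots> = (norm x)\<^sup>2 - (x \<bullet> v)\<^sup>2 / (norm v)\<^sup>2"
  proof -
    have "t0\<^sup>2 * (norm v)\<^sup>2 = (x \<bullet> v)\<^sup>2 / (norm v)\<^sup>2"
      using vv unfolding power2_norm_eq_inner t0_def
      by (simp add: power2_eq_square field_simps)
    then show ?thesis using pyth[of 0] by simp
  qed
  finally show ?thesis .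
qed

lemma vertex_invariant_bounds:
  "0 \<le> vertex_invariant J \<gamma> s" "vertex_invariant J \<gamma> s \<le> (norm (\<gamma> s))\<^sup>2"
proof -
  let ?v = "velocity J \<gamma> s"
  have "(\<gamma> s \<bullet> ?v)\<^sup>2 \<le> (norm (\<gamma> s))\<^sup>2 * (norm ?v)\<^sup>2"
    using Cauchy_Schwarz_ineq[of "\<gamma> s" ?v] by (simp add: power2_norm_eq_inner)
  then show "0 \<le> vertex_invariant J \<gamma> s"
    unfolding vertex_invariant_def by (cases "?v = 0") (auto simp: divide_simps)
  show "vertex_invariant J \<gamma> s \<le> (norm (\<gamma> s))\<^sup>2"
    unfolding vertex_invariant_def by simp
qed

lemma velocity_has_vector_derivative:
  assumes "\<gamma> differentiable (at s within J)"
  shows "(\<gamma> has_vector_derivative velocity J \<gamma> s) (at s within J)"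
  using assms unfolding velocity_def by (simp add: vector_derivative_works[symmetric])

text \<open>If the constant speed were zero, the derivative would vanish on the whole interval.\<close>

lemma cone_geodesic_velocity_nonzero:
  assumes geo: "cone_geodesic K J \<gamma>" and "s \<in> J"
  shows "velocity J \<gamma> s \<noteq> 0"
proof
  assume zero: "velocity J \<gamma> s = 0"
  have "\<exists>c. \<forall>t\<in>J. \<gamma> t = c"
  proof (rule has_vector_derivative_zero_constant)
    show "convex J" using geo by (simp add: cone_geodesic_def is_interval_convex)
    fix t assume "t \<in> J"
    have "norm (velocity J \<gamma> t) = norm (velocity J \<gamma> s)"
      using geo \<open>s \<in> J\<close> \<open>t \<in> J\<close> unfolding cone_geodesic_def constant_on_def by metis
    moreover have "\<gamma> differentiable (at t within J)"
      using geo \<open>t \<in> J\<close> by (simp add: cone_geodesic_def differentiable_on_def)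
    ultimately show "(\<gamma> has_vector_derivative 0) (at t within J)"
      using velocity_has_vector_derivative[of \<gamma> t J] zero by simp
  qed metis
  then show False
    using geo unfolding cone_geodesic_def constant_on_def by blast
qed

text \<open>
  The bounds \<open>0 \<le> I \<le> \<parallel>\<gamma>\<parallel>\<^sup>2\<close> squeeze the difference quotient of \<open>I\<close> at a parameter where \<open>\<gamma>\<close> meets
  the vertex, since \<open>\<parallel>\<gamma>\<parallel>\<^sup>2\<close> has derivative \<open>2 (\<gamma> \<bullet> \<gamma>') = 0\<close> there.
\<close>

lemma vertex_invariant_derivative_at_vertex:
  assumes diff: "\<gamma> differentiable (at s within J)" and zero: "\<gamma> s = 0"
  shows "(vertex_invariant J \<gamma> has_vector_derivative 0) (at s within J)"
proof -
  have "((\<lambda>t. \<gamma> t \<bullet> \<gamma> t) has_vector_derivative 0) (at s within J)"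
    using bounded_bilinear.has_vector_derivative[OF bounded_bilinear_inner
        velocity_has_vector_derivative[OF diff] velocity_has_vector_derivative[OF diff]]
    by (simp add: zero)
  then have lim: "((\<lambda>t. (norm (\<gamma> t))\<^sup>2 / norm (t - s)) \<longlongrightarrow> 0) (at s within J)"
    by (simp add: has_vector_derivative_def has_derivative_iff_norm zero
        power2_norm_eq_inner)
  have I0: "vertex_invariant J \<gamma> s = 0"
    by (simp add: vertex_invariant_def zero)
  have "((\<lambda>t. norm (vertex_invariant J \<gamma> t) / norm (t - s)) \<longlongrightarrow> 0) (at s within J)"
    by (rule tendsto_sandwich[OF _ _ tendsto_const lim])
      (auto intro!: divide_right_mono always_eventually simp: vertex_invariant_bounds)
  then show ?thesis
    by (simp add: has_vector_derivative_def has_derivative_iff_norm I0)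
qed

text \<open>
  Off the vertex the acceleration is orthogonal to the position vector, so \<open>\<gamma> \<bullet> \<gamma>'\<close> grows at the
  constant rate \<open>\<parallel>\<gamma>'\<parallel>\<^sup>2\<close>, which is what makes the two terms of \<open>I\<close> cancel.
\<close>

lemma vertex_invariant_derivative_off_vertex:
  assumes geo: "cone_geodesic (cone_over \<Gamma>) J \<gamma>" and "s \<in> J" and nz: "\<gamma> s \<noteq> 0"
  shows "(vertex_invariant J \<gamma> has_vector_derivative 0) (at s within J)"
proof -
  let ?v = "velocity J \<gamma>"
  define C where "C = (norm (?v s))\<^sup>2"
  have speed: "(norm (?v t))\<^sup>2 = C" if "t \<in> J" for t
    using geo \<open>s \<in> J\<close> that unfolding cone_geodesic_def constant_on_def C_def by metis
  have "C \<noteq> 0"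
    using cone_geodesic_velocity_nonzero[OF geo \<open>s \<in> J\<close>] by (simp add: C_def)
  have d\<gamma>: "(\<gamma> has_vector_derivative ?v s) (at s within J)"
    using geo \<open>s \<in> J\<close>
    by (intro velocity_has_vector_derivative) (simp add: cone_geodesic_def differentiable_on_def)
  have dv: "(?v has_vector_derivative velocity J ?v s) (at s within J)"
    using geo \<open>s \<in> J\<close> nz
    by (intro velocity_has_vector_derivative) (simp add: cone_geodesic_def)
  have "\<gamma> s \<in> tangent_space (cone_over \<Gamma>) (\<gamma> s)"
    using geo \<open>s \<in> J\<close> by (intro position_in_tangent_space_cone_over) (auto simp: cone_geodesic_def)
  then have orth: "\<gamma> s \<bullet> velocity J ?v s = 0"
    using geo \<open>s \<in> J\<close> nz by (simp add: cone_geodesic_def orthogonal_def inner_commute)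
  have dg: "((\<lambda>t. \<gamma> t \<bullet> ?v t) has_real_derivative C) (at s within J)"
    using bounded_bilinear.has_vector_derivative[OF bounded_bilinear_inner d\<gamma> dv] orth
    by (simp add: has_real_derivative_iff_has_vector_derivative C_def power2_norm_eq_inner)
  have dn: "((\<lambda>t. \<gamma> t \<bullet> \<gamma> t) has_real_derivative 2 * (\<gamma> s \<bullet> ?v s)) (at s within J)"
    using bounded_bilinear.has_vector_derivative[OF bounded_bilinear_inner d\<gamma> d\<gamma>]
    by (simp add: has_real_derivative_iff_has_vector_derivative inner_commute)
  have "((\<lambda>t. \<gamma> t \<bullet> \<gamma> t - (\<gamma> t \<bullet> ?v t)\<^sup>2 / C) has_real_derivative 0) (at s within J)"
    using \<open>C \<noteq> 0\<close> by (auto intro!: derivative_eq_intros dg dn)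
  then have "((\<lambda>t. \<gamma> t \<bullet> \<gamma> t - (\<gamma> t \<bullet> ?v t)\<^sup>2 / C) has_vector_derivative 0) (at s within J)"
    by (simp add: has_real_derivative_iff_has_vector_derivative)
  then show ?thesis
    by (rule has_vector_derivative_transform[OF \<open>s \<in> J\<close>, rotated])
      (simp add: vertex_invariant_def speed power2_norm_eq_inner[symmetric])
qed

theorem lemma1:
  fixes \<Gamma> :: "((real ^ 'N) \<times> real) set" and n :: nat
    and J :: "real set" and \<gamma> :: "real \<Rightarrow> (real ^ 'N) \<times> real"
  assumes "n < CARD('N)"
    and "compact \<Gamma>" and "C_k_submanifold 3 n \<Gamma>"
    and "\<Gamma> \<subseteq> {x. snd x = 1}"
    and "cone_geodesic (cone_over \<Gamma>) J \<gamma>"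
  shows "vertex_invariant J \<gamma> constant_on J \<and>
         (\<forall>s\<in>J. vertex_invariant J \<gamma> s = (infdist 0 (tangent_line J \<gamma> s))\<^sup>2)"
proof (intro conjI ballI)
  note geo = \<open>cone_geodesic (cone_over \<Gamma>) J \<gamma>\<close>
  have "\<exists>c. \<forall>s\<in>J. vertex_invariant J \<gamma> s = c"
  proof (rule has_vector_derivative_zero_constant)
    show "convex J" using geo by (simp add: cone_geodesic_def is_interval_convex)
    fix s assume "s \<in> J"
    then have "\<gamma> differentiable (at s within J)"
      using geo by (simp add: cone_geodesic_def differentiable_on_def)
    then show "(vertex_invariant J \<gamma> has_vector_derivative 0) (at s within J)"
      using vertex_invariant_derivative_at_vertex
        vertex_invariant_derivative_off_vertex[OF geo \<open>s \<in> J\<close>] by blast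
  qed metis
  then show "vertex_invariant J \<gamma> constant_on J"
    by (simp add: constant_on_def)
  fix s assume "s \<in> J"
  show "vertex_invariant J \<gamma> s = (infdist 0 (tangent_line J \<gamma> s))\<^sup>2"
    using infdist_0_line_squared[OF cone_geodesic_velocity_nonzero[OF geo \<open>s \<in> J\<close>]]
    by (simp add: vertex_invariant_def tangent_line_def)
qed

end
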